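(* Let $d\ge2$, let $\boldsymbol{L}$ be a full-rank structured matrix built from jointly diagonalizable pairs $\boldsymbol{M}^{(k)},\boldsymbol{S}^{(k)}\in\mathbb{C}^{n_k\times n_k}$ ($k=1,\dots,d$), with joint diagonal entries $\lambda^{(k)}_j\neq0$ (of $\boldsymbol{U}_k\boldsymbol{M}^{(k)}\boldsymbol{V}_k$) and $\mu^{(k)}_j$ (of $\boldsymbol{U}_k\boldsymbol{S}^{(k)}\boldsymbol{V}_k$), and let $\mathcal{L}$ be the associated tensor, all as in the context. For $k\in\{1,\ldots,d-1\}$ put $$P_k=\left\{\sum_{s=1}^k\frac{\mu_{j_s}^{(s)}}{\lambda_{j_s}^{(s)}}:1\le j_s\le n_s\right\},\qquad Q_k=\left\{-\sum_{s=k+1}^d\frac{\mu_{j_s}^{(s)}}{\lambda_{j_s}^{(s)}}:1\le j_s\le n_s\right\}.$$ Suppose that for every $k\in\{1,\ldots,d-1\}$ there is a closed disk $\mathcal{D}_k=\{z\in\mathbb{C}:|z-c_k|\le D_k\}$ with $D_k>0$ such that one of $P_k,Q_k$ is contained in $\mathcal{D}_k$ and the other is disjoint from $\mathcal{D}_k$; let $D_k'>0$ be the distance between the latter set and $\mathcal{D}_k$, and let $\tau_k=\frac{D_k}{D_k+D_k'}$. Let $\varepsilon\in(0,1)$ and $$\mathcal{S}=\left\{\mathcal{Y}\in\mathbb{C}^{n_1\times\cdots\times n_d}:\|\mathcal{L}^{\odot-1}-\mathcal{Y}\|_F\le\varepsilon\|\mathcal{L}^{\odot-1}\|_F\right\}.$$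 Then there exists a tensor $\mathcal{Y}\in\mathcal{S}$ whose TT ranks $(r_0,r_1,\ldots,r_d)$, $r_0=r_d=1$, satisfy $$r_k\le\left\lceil\log_{\tau_k^2}\left(\frac{(1-\tau_k^2)\varepsilon^2}{d-1}+\tau_k^{2N_k}\right)\right\rceil,\qquad k=1,2,\ldots,d-1,$$ where $N_k=\min\left\{n_kr_{k-1},\prod_{s=k+1}^dn_s\right\}$.
   Context: Structured matrix: $\boldsymbol{L}\in\mathbb{C}^{\prod_k n_k\times\prod_k n_k}$ is a full-rank (invertible) matrix of the form $$\boldsymbol{L}=\sum_{k=1}^d\boldsymbol{M}^{(1)}\otimes\cdots\otimes\boldsymbol{M}^{(k-1)}\otimes\boldsymbol{S}^{(k)}\otimes\boldsymbol{M}^{(k+1)}\otimes\cdots\otimes\boldsymbol{M}^{(d)}$$ (Kronecker products), where for every $k$ the matrices $\boldsymbol{M}^{(k)},\boldsymbol{S}^{(k)}\in\mathbb{C}^{n_k\times n_k}$ are jointly diagonalizable: there are invertible $\boldsymbol{U}_k,\boldsymbol{V}_k\in\mathbb{C}^{n_k\times n_k}$ with $\boldsymbol{U}_k\boldsymbol{S}^{(k)}\boldsymbol{V}_k=\mathrm{diag}(\mu^{(k)}_1,\ldots,\mu^{(k)}_{n_k})$ and $\boldsymbol{U}_k\boldsymbol{M}^{(k)}\boldsymbol{V}_k=\mathrm{diag}(\lambda^{(k)}_1,\ldots,\lambda^{(k)}_{n_k})$. Associated tensor: $\mathcal{L}\in\mathbb{C}^{n_1\times\cdots\times n_d}$ has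 entries $$\mathcal{L}(j_1,\ldots,j_d)=\sum_{k=1}^d\lambda^{(1)}_{j_1}\cdots\lambda^{(k-1)}_{j_{k-1}}\mu^{(k)}_{j_k}\lambda^{(k+1)}_{j_{k+1}}\cdots\lambda^{(d)}_{j_d},$$ all nonzero since $\boldsymbol{L}$ has full rank. Its Hadamard inverse $\mathcal{L}^{\odot-1}$ is the entrywise reciprocal. $\|\cdot\|_F$ is the Frobenius norm (square root of the sum of squared moduli of all entries). Tensor-train (TT) format: a tensor $\mathcal{Y}$ has TT ranks $(r_0,r_1,\ldots,r_d)$ with $r_0=r_d=1$ if it is represented as $$\mathcal{Y}(i_1,\ldots,i_d)=\mathcal{Y}^{(1)}(:,i_1,:)\,\mathcal{Y}^{(2)}(:,i_2,:)\cdots\mathcal{Y}^{(d)}(:,i_d,:)$$ (a product of matrices) with TT cores $\mathcal{Y}^{(k)}\in\mathbb{C}^{r_{k-1}\times n_k\times r_k}$. *)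

theory Defs
  imports "HOL-Analysis.Analysis" "Jordan_Normal_Form.Matrix"
begin

(* Modes are numbered 1..d, whereas entries of matrices and tensors are numbered from 0:
   the k-th index j k of a tensor ranges over 0, ..., n k - 1. *)

definition kron :: "complex mat \<Rightarrow> complex mat \<Rightarrow> complex mat" where
  "kron A B = Matrix.mat (dim_row A * dim_row B) (dim_col A * dim_col B)
     (\<lambda>(i, j). A $$ (i div dim_row B, j div dim_col B) * B $$ (i mod dim_row B, j mod dim_col B))"

definition kron_list :: "complex mat list \<Rightarrow> complex mat" where
  "kron_list As = foldr kron As (1\<^sub>m 1)"

(* The sum of the Kronecker products is taken entrywise because matrices of type "complex mat"
   carry their dimensions as values and do not form a type-class monoid. *)
definition structured_matrix ::
  "nat \<Rightarrow> (nat \<Rightarrow> nat) \<Rightarrow> (nat \<Rightarrow> complex mat) \<Rightarrow> (nat \<Rightarrow> complex mat) \<Rightarrow> complex mat" where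
  "structured_matrix d n M S = Matrix.mat (\<Prod>k = 1..d. n k) (\<Prod>k = 1..d. n k)
     (\<lambda>ij. \<Sum>k = 1..d. kron_list (map M [1..<k] @ [S k] @ map M [k + 1..<d + 1]) $$ ij)"

definition joint_diagonalization ::
  "nat \<Rightarrow> complex mat \<Rightarrow> complex mat \<Rightarrow> complex mat \<Rightarrow> complex mat
     \<Rightarrow> (nat \<Rightarrow> complex) \<Rightarrow> (nat \<Rightarrow> complex) \<Rightarrow> bool" where
  "joint_diagonalization m U V M S lam mu \<longleftrightarrow>
     U \<in> carrier_mat m m \<and> V \<in> carrier_mat m m \<and> M \<in> carrier_mat m m \<and> S \<in> carrier_mat m m \<and>
     invertible_mat U \<and> invertible_mat V \<and>
     U * S * V = mat_diag m mu \<and> U * M * V = mat_diag m lam"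

definition multi_indices :: "nat \<Rightarrow> (nat \<Rightarrow> nat) \<Rightarrow> (nat \<Rightarrow> nat) set" where
  "multi_indices d n = (\<Pi>\<^sub>E k\<in>{1..d}. {..<n k})"

(* A tensor of size n 1 x ... x n d is a function on multi-indices; its values outside
   "multi_indices d n" are never used. *)
type_synonym tensor = "(nat \<Rightarrow> nat) \<Rightarrow> complex"

definition frob_norm :: "nat \<Rightarrow> (nat \<Rightarrow> nat) \<Rightarrow> tensor \<Rightarrow> real" where
  "frob_norm d n X = sqrt (\<Sum>j\<in>multi_indices d n. (cmod (X j))\<^sup>2)"

definition hadamard_inverse :: "tensor \<Rightarrow> tensor" where
  "hadamard_inverse X = (\<lambda>j. inverse (X j))"

definition associated_tensor ::
  "nat \<Rightarrow> (nat \<Rightarrow> nat \<Rightarrow> complex) \<Rightarrow> (nat \<Rightarrow> nat \<Rightarrow> complex) \<Rightarrow> tensor" where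
  "associated_tensor d lam mu = (\<lambda>j.
     \<Sum>k = 1..d. (\<Prod>s = 1..<k. lam s (j s)) * mu k (j k) * (\<Prod>s = k + 1..d. lam s (j s)))"

(* "G k i" is the slice G^(k)(:, i, :) of the k-th core. The factor 1\<^sub>m (r d) only terminates
   the fold. *)
definition has_tt_ranks :: "nat \<Rightarrow> (nat \<Rightarrow> nat) \<Rightarrow> (nat \<Rightarrow> nat) \<Rightarrow> tensor \<Rightarrow> bool" where
  "has_tt_ranks d n r Y \<longleftrightarrow>
     r 0 = 1 \<and> r d = 1 \<and> (\<forall>k\<le>d. 0 < r k) \<and>
     (\<exists>G :: nat \<Rightarrow> nat \<Rightarrow> complex mat.
        (\<forall>k\<in>{1..d}. \<forall>i<n k. G k i \<in> carrier_mat (r (k - 1)) (r k)) \<and>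
        (\<forall>j\<in>multi_indices d n.
           Y j = foldr (*) (map (\<lambda>k. G k (j k)) [1..<d + 1]) (1\<^sub>m (r d)) $$ (0, 0)))"

definition P_set ::
  "(nat \<Rightarrow> nat) \<Rightarrow> (nat \<Rightarrow> nat \<Rightarrow> complex) \<Rightarrow> (nat \<Rightarrow> nat \<Rightarrow> complex) \<Rightarrow> nat \<Rightarrow> complex set" where
  "P_set n lam mu k =
     {\<Sum>s = 1..k. mu s (j s) / lam s (j s) | j. \<forall>s\<in>{1..k}. j s < n s}"

definition Q_set ::
  "nat \<Rightarrow> (nat \<Rightarrow> nat) \<Rightarrow> (nat \<Rightarrow> nat \<Rightarrow> complex) \<Rightarrow> (nat \<Rightarrow> nat \<Rightarrow> complex) \<Rightarrow> nat
     \<Rightarrow> complex set" where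
  "Q_set d n lam mu k =
     {- (\<Sum>s = k + 1..d. mu s (j s) / lam s (j s)) | j. \<forall>s\<in>{k + 1..d}. j s < n s}"

definition disk_separates :: "complex \<Rightarrow> real \<Rightarrow> real \<Rightarrow> complex set \<Rightarrow> complex set \<Rightarrow> bool" where
  "disk_separates c D D' A B \<longleftrightarrow>
     A \<subseteq> cball c D \<and> B \<inter> cball c D = {} \<and> D' = setdist B (cball c D)"

end

(* Up to rank-one factors the k-th unfolding of the Hadamard inverse is the Cauchy matrix
   1 / (p - q) with p in P_k and q in Q_k. Expanding around the centre c_k of the disk, the
   geometric series truncated after R terms is a rank-R approximation whose entrywise relative
   error is at most \<tau>_k ^ R. If the prescribed rank is smaller than N_k, then
   \<tau>_k ^ (2 * N_k) \<le> \<tau>_k ^ (2 * R + 2), and the rank bound gives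
   \<tau>_k ^ (2 * R) \<le> \<epsilon>^2 / (d - 1); if it equals N_k, that step is exact.
   As in the TT-SVD, separating the modes one at a time by orthogonal projections combines these
   approximations, and the squared errors of the d - 1 unfoldings add up. The projections are
   onto the column spaces of the explicit approximations, so no singular value decomposition
   enters. *)
theory Submission
  imports Defs
begin

section \<open>Inner products, orthonormal families and projections on a finite index set\<close>

definition cinner_on :: "'a set \<Rightarrow> ('a \<Rightarrow> complex) \<Rightarrow> ('a \<Rightarrow> complex) \<Rightarrow> complex" where
  "cinner_on A v w = (\<Sum>x\<in>A. v x * cnj (w x))"

definition norm2_on :: "'a set \<Rightarrow> ('a \<Rightarrow> complex) \<Rightarrow> real" where
  "norm2_on A v = (\<Sum>x\<in>A. (cmod (v x))\<^sup>2)"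

lemma cinner_on_self: "cinner_on A v v = of_real (norm2_on A v)"
  unfolding cinner_on_def norm2_on_def of_real_sum
  by (intro sum.cong refl) (simp only: complex_norm_square)

lemma norm2_on_nonneg: "0 \<le> norm2_on A v"
  unfolding norm2_on_def by (simp add: sum_nonneg)

lemma norm2_on_eq_0_iff: "finite A \<Longrightarrow> norm2_on A v = 0 \<longleftrightarrow> (\<forall>x\<in>A. v x = 0)"
  unfolding norm2_on_def by (subst sum_nonneg_eq_0_iff) auto

lemma cinner_on_commute: "cinner_on A w v = cnj (cinner_on A v w)"
  unfolding cinner_on_def by (simp add: mult.commute)

lemma cinner_on_diff_left:
  "cinner_on A (\<lambda>x. v x - w x) t = cinner_on A v t - cinner_on A w t"
  unfolding cinner_on_def by (simp add: sum_subtractf algebra_simps)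

lemma cinner_on_scale_right: "cinner_on A t (\<lambda>x. c * v x) = cnj c * cinner_on A t v"
  unfolding cinner_on_def by (simp add: sum_distrib_left algebra_simps)

lemma cinner_on_sum_left:
  "cinner_on A (\<lambda>x. \<Sum>m\<in>I. c m * w m x) t = (\<Sum>m\<in>I. c m * cinner_on A (w m) t)"
  unfolding cinner_on_def
  by (simp add: sum_distrib_left sum_distrib_right mult.assoc) (rule sum.swap)

lemma cinner_on_sum_right:
  "cinner_on A t (\<lambda>x. \<Sum>m\<in>I. c m * w m x) = (\<Sum>m\<in>I. cnj (c m) * cinner_on A t (w m))"
  using cinner_on_sum_left[of A c w I t]
  by (subst cinner_on_commute) (simp add: cinner_on_commute[of A t])

lemma cinner_on_cong:
  "\<lbrakk>\<And>x. x \<in> A \<Longrightarrow> v x = v' x; \<And>x. x \<in> A \<Longrightarrow> w x = w' x\<rbrakk> \<Longrightarrow> cinner_on A v w = cinner_on A v' w'"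
  unfolding cinner_on_def by (auto intro: sum.cong)

lemma norm2_on_pythagoras:
  assumes "cinner_on A v w = 0"
  shows "norm2_on A (\<lambda>x. v x + w x) = norm2_on A v + norm2_on A w"
proof -
  have "complex_of_real (norm2_on A (\<lambda>x. v x + w x)) = cinner_on A v v + cinner_on A v w
      + cinner_on A w v + cinner_on A w w"
    unfolding cinner_on_self[symmetric] by (simp add: cinner_on_def algebra_simps sum.distrib)
  also have "\<dots> = complex_of_real (norm2_on A v + norm2_on A w)"
    using assms by (simp add: cinner_on_commute[of A w v] cinner_on_self)
  finally show ?thesis
    unfolding of_real_eq_iff .
qed

definition orthonormal_or_zero :: "'a set \<Rightarrow> nat \<Rightarrow> (nat \<Rightarrow> 'a \<Rightarrow> complex) \<Rightarrow> bool" where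
  "orthonormal_or_zero A r u \<longleftrightarrow>
     (\<forall>l<r. \<forall>m<r. l \<noteq> m \<longrightarrow> cinner_on A (u l) (u m) = 0) \<and>
     (\<forall>m<r. norm2_on A (u m) = 1 \<or> norm2_on A (u m) = 0)"

definition proj_on :: "'a set \<Rightarrow> nat \<Rightarrow> (nat \<Rightarrow> 'a \<Rightarrow> complex) \<Rightarrow> ('a \<Rightarrow> complex) \<Rightarrow> 'a \<Rightarrow> complex"
  where "proj_on A r u v x = (\<Sum>l<r. cinner_on A v (u l) * u l x)"

lemma cinner_on_combination:
  assumes "orthonormal_or_zero A r u" "m < r"
  shows "cinner_on A (\<lambda>x. \<Sum>l<r. c l * u l x) (u m) = c m * of_real (norm2_on A (u m))"
proof -
  have "cinner_on A (\<lambda>x. \<Sum>l<r. c l * u l x) (u m) = (\<Sum>l<r. c l * cinner_on A (u l) (u m))"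
    by (rule cinner_on_sum_left)
  also have "\<dots> = (\<Sum>l<r. if l = m then c m * of_real (norm2_on A (u m)) else 0)"
    using assms by (intro sum.cong) (auto simp: orthonormal_or_zero_def cinner_on_self)
  finally show ?thesis
    using assms(2) by simp
qed

lemma cinner_on_proj_on:
  assumes "finite A" "orthonormal_or_zero A r u" "m < r"
  shows "cinner_on A (proj_on A r u v) (u m) = cinner_on A v (u m)"
proof -
  have "cinner_on A (proj_on A r u v) (u m) = cinner_on A v (u m) * of_real (norm2_on A (u m))"
    using cinner_on_combination[OF assms(2,3), of "\<lambda>l. cinner_on A v (u l)"]
    by (simp add: proj_on_def[abs_def])
  \<comment> \<open>A vector of norm zero vanishes on \<open>A\<close>, so in that case both
    coefficients are 0.\<close>
  moreover have "cinner_on A v (u m) = 0" if "norm2_on A (u m) = 0"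
    using that norm2_on_eq_0_iff[OF assms(1)] by (simp add: cinner_on_def)
  ultimately show ?thesis
    using assms(2,3) by (auto simp: orthonormal_or_zero_def)
qed

lemma cinner_on_residual:
  assumes "finite A" "orthonormal_or_zero A r u"
  shows "cinner_on A (\<lambda>x. v x - proj_on A r u v x) (\<lambda>x. \<Sum>l<r. c l * u l x) = 0"
  using assms by (simp add: cinner_on_sum_right cinner_on_diff_left cinner_on_proj_on)

text \<open>Parseval, weakened to an inequality because coefficients of zero vectors are
  lost.\<close>

lemma norm2_on_combination_le:
  assumes "orthonormal_or_zero A r u"
  shows "norm2_on A (\<lambda>x. \<Sum>l<r. c l * u l x) \<le> (\<Sum>l<r. (cmod (c l))\<^sup>2)"
proof -
  have "complex_of_real (norm2_on A (\<lambda>x. \<Sum>l<r. c l * u l x))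
      = (\<Sum>m<r. cnj (c m) * (c m * of_real (norm2_on A (u m))))"
    using assms by (simp flip: cinner_on_self add: cinner_on_sum_right cinner_on_combination)
  also have "\<dots> = complex_of_real (\<Sum>m<r. (cmod (c m))\<^sup>2 * norm2_on A (u m))"
    by (simp add: complex_norm_square mult.commute mult.left_commute del: of_real_power)
  finally have "norm2_on A (\<lambda>x. \<Sum>l<r. c l * u l x) = (\<Sum>m<r. (cmod (c m))\<^sup>2 * norm2_on A (u m))"
    unfolding of_real_eq_iff .
  also have "\<dots> \<le> (\<Sum>l<r. (cmod (c l))\<^sup>2)"
    using assms by (intro sum_mono) (auto simp: orthonormal_or_zero_def)
  finally show ?thesis .
qed

text \<open>Membership of \<open>w m\<close> in the span of \<open>u\<close> is encoded as
  invariance under \<open>proj_on\<close>. The induction appends the normalised residual of the next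
  vector.\<close>

lemma gram_schmidt:
  fixes w :: "nat \<Rightarrow> 'a \<Rightarrow> complex"
  assumes "finite A"
  shows "\<exists>u. orthonormal_or_zero A r u \<and> (\<forall>m<r. \<forall>x\<in>A. w m x = proj_on A r u (w m) x)"
proof (induction r)
  case 0
  show ?case by (simp add: orthonormal_or_zero_def)
next
  case (Suc r)
  then obtain u where u: "orthonormal_or_zero A r u"
    and span: "\<And>m x. m < r \<Longrightarrow> x \<in> A \<Longrightarrow> w m x = proj_on A r u (w m) x"
    by blast
  define q where "q x = w r x - proj_on A r u (w r) x" for x
  define s where "s = sqrt (norm2_on A q)"
  have s2: "s * s = norm2_on A q"
    by (simp add: s_def norm2_on_nonneg)
  \<comment> \<open>If the residual vanishes then \<open>s = 0\<close>, and
    \<open>inverse 0 = 0\<close> makes \<open>ur\<close> the zero vector.\<close>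
  define ur where "ur x = complex_of_real (inverse s) * q x" for x
  define u' where "u' = u(r := ur)"
  have u'_less: "u' l = u l" if "l < r" for l
    using that by (simp add: u'_def)
  have u'_r: "u' r = ur"
    by (simp add: u'_def)
  have ur_scale: "cinner_on A t ur = of_real (inverse s) * cinner_on A t q" for t
    using cinner_on_scale_right[of A t "of_real (inverse s)" q] by (simp add: ur_def[abs_def])
  have q_perp: "cinner_on A (\<lambda>x. \<Sum>l<r. c l * u l x) q = 0" for c
    using cinner_on_residual[OF assms u, of "w r" c]
    by (subst cinner_on_commute) (simp add: q_def[abs_def])
  have proj_perp: "cinner_on A (proj_on A r u v) q = 0" for v
    using q_perp by (simp add: proj_on_def[abs_def])
  have u_perp: "cinner_on A (u l) ur = 0" if "l < r" for l
  proof -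
    have "(\<lambda>x. \<Sum>i<r. (if i = l then 1 else 0) * u i x) = u l"
      using that by (auto simp: if_distrib[of "\<lambda>t. t * _"] cong: if_cong)
    then show ?thesis
      using q_perp[of "\<lambda>i. if i = l then 1 else 0"] by (simp add: ur_scale)
  qed
  have ur_norm: "norm2_on A ur = 1 \<or> norm2_on A ur = 0"
  proof -
    have "norm2_on A ur = (\<Sum>x\<in>A. (inverse s)\<^sup>2 * (cmod (q x))\<^sup>2)"
      unfolding norm2_on_def ur_def by (simp add: norm_mult power_mult_distrib norm_inverse power_inverse)
    also have "\<dots> = (inverse s)\<^sup>2 * (s * s)"
      unfolding s2 norm2_on_def by (simp add: sum_distrib_left)
    finally show ?thesis
      by (cases "s = 0") (auto simp: power2_eq_square field_simps)
  qed
  have on: "orthonormal_or_zero A (Suc r) u'"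
    unfolding orthonormal_or_zero_def
  proof (intro conjI allI impI)
    fix l m assume "l < Suc r" "m < Suc r" "l \<noteq> m"
    then consider "l < r" "m < r" | "l < r" "m = r" | "l = r" "m < r"
      by linarith
    then show "cinner_on A (u' l) (u' m) = 0"
    proof cases
      case 1
      then show ?thesis
        using u \<open>l \<noteq> m\<close> by (auto simp: u'_less orthonormal_or_zero_def)
    next
      case 2
      then show ?thesis
        using u_perp by (simp add: u'_less u'_r)
    next
      case 3
      then show ?thesis
        using u_perp cinner_on_commute[of A ur "u m"] by (simp add: u'_less u'_r)
    qed
  next
    fix m assume "m < Suc r"
    then show "norm2_on A (u' m) = 1 \<or> norm2_on A (u' m) = 0"
      using u ur_norm by (auto simp: less_Suc_eq u'_less u'_r orthonormal_or_zero_def)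
  qed
  have proj_Suc: "proj_on A (Suc r) u' v x = proj_on A r u v x + cinner_on A v ur * ur x" for v x
    by (simp add: proj_on_def u'_less u'_r)
  have "w m x = proj_on A (Suc r) u' (w m) x" if m: "m < Suc r" and x: "x \<in> A" for m x
  proof (cases "m < r")
    case True
    \<comment> \<open>An earlier vector equals its old projection, which is orthogonal to
      \<open>q\<close>; enlarging the family adds nothing to its projection.\<close>
    have "cinner_on A (w m) ur = of_real (inverse s) * cinner_on A (proj_on A r u (w m)) q"
      unfolding ur_scale using span[OF True] by (simp cong: cinner_on_cong)
    then show ?thesis
      using span[OF True x] by (simp add: proj_Suc proj_perp)
  next
    case False
    then have [simp]: "m = r" using m by simp
    \<comment> \<open>\<open>w r\<close> and \<open>q\<close> differ by the old projection, which is
      orthogonal to \<open>q\<close>. Hence the new term of the projection is precisely the missing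
      residual \<open>q x\<close>.\<close>
    have "cinner_on A (w r) q = cinner_on A q q"
      unfolding q_def[abs_def] cinner_on_diff_left[of A "w r"]
      using proj_perp[of "w r"] by (simp add: q_def[abs_def])
    then have ip: "cinner_on A (w r) ur = of_real (inverse s * (s * s))"
      unfolding ur_scale s2 by (simp add: cinner_on_self)
    have "cinner_on A (w r) ur * ur x = q x"
    proof (cases "s = 0")
      case True
      then have "q x = 0"
        using s2 x norm2_on_eq_0_iff[OF assms] by simp
      then show ?thesis by (simp add: ur_def)
    next
      case False
      then show ?thesis
        unfolding ip ur_def by (simp add: field_simps flip: of_real_mult)
    qed
    then show ?thesis
      by (simp add: proj_Suc q_def)
  qed
  with on show ?case
    by blast
qed

text \<open>Pythagoras for residual plus projection. The squared norm of the projection is exactly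
  the coefficient sum, since coefficients at zero vectors vanish.\<close>

lemma bessel:
  assumes "finite A" "orthonormal_or_zero A r u"
  shows "(\<Sum>m<r. (cmod (cinner_on A v (u m)))\<^sup>2) \<le> norm2_on A v"
proof -
  have "complex_of_real (norm2_on A (proj_on A r u v))
      = (\<Sum>m<r. cnj (cinner_on A v (u m)) * cinner_on A (proj_on A r u v) (u m))"
    unfolding cinner_on_self[symmetric]
    by (subst (2) proj_on_def[abs_def]) (rule cinner_on_sum_right)
  also have "\<dots> = complex_of_real (\<Sum>m<r. (cmod (cinner_on A v (u m)))\<^sup>2)"
    using cinner_on_proj_on[OF assms]
    by (simp add: complex_norm_square mult.commute del: of_real_power)
  finally have eq: "norm2_on A (proj_on A r u v) = (\<Sum>m<r. (cmod (cinner_on A v (u m)))\<^sup>2)"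
    unfolding of_real_eq_iff .
  have "norm2_on A v = norm2_on A (\<lambda>x. v x - proj_on A r u v x) + norm2_on A (proj_on A r u v)"
    using norm2_on_pythagoras[of A "\<lambda>x. v x - proj_on A r u v x" "proj_on A r u v"]
      cinner_on_residual[OF assms, of v "\<lambda>l. cinner_on A v (u l)"]
    by (simp add: proj_on_def[abs_def])
  then show ?thesis
    using norm2_on_nonneg[of A "\<lambda>x. v x - proj_on A r u v x"] eq by simp
qed

text \<open>The error splits orthogonally into the residual of \<open>v\<close> and an error inside
  the span. The residual is a best approximation error, hence at most the distance to any
  \<open>z\<close> in the span; the rest is controlled by the coefficients. This is why the errors
  of successive projections add in squares.\<close>

lemma approx_by_combination:
  assumes A: "finite A" and u: "orthonormal_or_zero A r u"
    and z: "\<And>x. x \<in> A \<Longrightarrow> z x = proj_on A r u z x"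
  shows "norm2_on A (\<lambda>x. v x - (\<Sum>m<r. y m * u m x))
      \<le> norm2_on A (\<lambda>x. v x - z x) + (\<Sum>m<r. (cmod (cinner_on A v (u m) - y m))\<^sup>2)"
proof -
  let ?res = "\<lambda>x. v x - proj_on A r u v x"
  have split: "norm2_on A (\<lambda>x. v x - (\<Sum>m<r. c m * u m x))
      = norm2_on A ?res + norm2_on A (\<lambda>x. \<Sum>m<r. (cinner_on A v (u m) - c m) * u m x)" for c
    using norm2_on_pythagoras[OF cinner_on_residual[OF A u, of v "\<lambda>m. cinner_on A v (u m) - c m"]]
    by (simp add: proj_on_def left_diff_distrib sum_subtractf)
  have "norm2_on A ?res \<le> norm2_on A (\<lambda>x. v x - proj_on A r u z x)"
    using split[of "\<lambda>m. cinner_on A z (u m)"] norm2_on_nonneg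
    by (simp add: proj_on_def)
  also have "\<dots> = norm2_on A (\<lambda>x. v x - z x)"
    using z by (simp add: norm2_on_def)
  finally have "norm2_on A ?res \<le> norm2_on A (\<lambda>x. v x - z x)" .
  then show ?thesis
    using split[of y] norm2_on_combination_le[OF u, of "\<lambda>m. cinner_on A v (u m) - y m"] by simp
qed

section \<open>Unfoldings, partial tensor trains and successive compression\<close>

abbreviation tail_indices :: "nat \<Rightarrow> nat \<Rightarrow> (nat \<Rightarrow> nat) \<Rightarrow> (nat \<Rightarrow> nat) set" where
  "tail_indices a d n \<equiv> (\<Pi>\<^sub>E k\<in>{Suc a..d}. {..<n k})"

lemma finite_tail_indices: "finite (tail_indices a d n)"
  by (intro finite_PiE) auto

lemma sum_tail_indices:
  assumes "a < d"
  shows "(\<Sum>j\<in>tail_indices a d n. F j)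
    = (\<Sum>i<n (Suc a). \<Sum>j\<in>tail_indices (Suc a) d n. F (j(Suc a := i)))"
proof -
  have "{Suc a..d} = insert (Suc a) {Suc (Suc a)..d}"
    using assms by auto
  then have "tail_indices a d n
      = (\<lambda>(i, j). j(Suc a := i)) ` ({..<n (Suc a)} \<times> tail_indices (Suc a) d n)"
    by (simp add: PiE_insert_eq)
  moreover have "inj_on (\<lambda>(i, j). j(Suc a := i)) ({..<n (Suc a)} \<times> tail_indices (Suc a) d n)"
    by (rule inj_combinator) simp
  ultimately show ?thesis
    by (simp add: sum.reindex sum.cartesian_product case_prod_unfold o_def)
qed

(* Here and below \<alpha> is an extra row index: compressing the first a modes of a tensor leaves
   r a components, each a tensor in the modes a+1, ..., d. *)
definition unfolding_rank_le :: "nat \<Rightarrow> nat \<Rightarrow> (nat \<Rightarrow> tensor) \<Rightarrow> bool" where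
  "unfolding_rank_le k r Z \<longleftrightarrow>
     (\<exists>f g. \<forall>\<alpha> j. Z \<alpha> j = (\<Sum>m<r. f m \<alpha> (restrict j {..k}) * g m (restrict j {k<..})))"

text \<open>The train formed by the cores of the modes after \<open>a\<close>, with a free row
  index. For \<open>a = 0\<close> and \<open>\<alpha> = 0\<close> it is the expression in
  \<open>has_tt_ranks\<close>; the general form serves the induction that puts one core in
  front.\<close>

definition tt_entry :: "nat \<Rightarrow> nat \<Rightarrow> (nat \<Rightarrow> nat) \<Rightarrow> (nat \<Rightarrow> nat \<Rightarrow> complex mat) \<Rightarrow> nat \<Rightarrow> tensor"
  where "tt_entry a d r G \<alpha> j
     = foldr (*) (map (\<lambda>k. G k (j k)) [Suc a..<d + 1]) (1\<^sub>m (r d)) $$ (\<alpha>, 0)"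

lemma foldr_mult_carrier:
  fixes G :: "nat \<Rightarrow> complex mat"
  assumes "a \<le> d" "\<And>k. k \<in> {Suc a..d} \<Longrightarrow> G k \<in> carrier_mat (r (k - 1)) (r k)"
  shows "foldr (*) (map G [Suc a..<d + 1]) (1\<^sub>m (r d)) \<in> carrier_mat (r a) (r d)"
  using assms
proof (induction rule: inc_induct)
  case base
  then show ?case by simp
next
  case (step a)
  then have "[Suc a..<d + 1] = Suc a # [Suc (Suc a)..<d + 1]"
    by (simp add: upt_conv_Cons)
  moreover have "G (Suc a) \<in> carrier_mat (r a) (r (Suc a))"
    using step.prems[of "Suc a"] step.hyps by simp
  moreover have "foldr (*) (map G [Suc (Suc a)..<d + 1]) (1\<^sub>m (r d))
      \<in> carrier_mat (r (Suc a)) (r d)"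
    using step by auto
  ultimately show ?case
    by simp
qed

lemma tt_entry_Suc:
  assumes "a < d" "0 < r d" "\<alpha> < r a"
    and "\<And>k. k \<in> {Suc a..d} \<Longrightarrow> G k (j k) \<in> carrier_mat (r (k - 1)) (r k)"
  shows "tt_entry a d r G \<alpha> j
    = (\<Sum>m<r (Suc a). G (Suc a) (j (Suc a)) $$ (\<alpha>, m) * tt_entry (Suc a) d r G m j)"
proof -
  have upt: "[Suc a..<d + 1] = Suc a # [Suc (Suc a)..<d + 1]"
    using assms(1) by (simp add: upt_conv_Cons)
  have G: "G (Suc a) (j (Suc a)) \<in> carrier_mat (r a) (r (Suc a))"
    using assms(4)[of "Suc a"] assms(1) by simp
  let ?T = "foldr (*) (map (\<lambda>k. G k (j k)) [Suc (Suc a)..<d + 1]) (1\<^sub>m (r d))"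
  have T: "?T \<in> carrier_mat (r (Suc a)) (r d)"
    using assms by (intro foldr_mult_carrier) auto
  have "tt_entry a d r G \<alpha> j = (G (Suc a) (j (Suc a)) * ?T) $$ (\<alpha>, 0)"
    unfolding tt_entry_def upt by simp
  also have "\<dots> = (\<Sum>m = 0..<r (Suc a). G (Suc a) (j (Suc a)) $$ (\<alpha>, m) * ?T $$ (m, 0))"
    using G T assms(2,3) by (auto simp: scalar_prod_def intro!: sum.cong)
  finally show ?thesis
    by (simp add: tt_entry_def atLeast0LessThan)
qed

lemma tt_entry_cong:
  assumes "\<And>k. k \<in> {Suc a..d} \<Longrightarrow> G k (j k) = G' k (j' k)"
  shows "tt_entry a d r G \<alpha> j = tt_entry a d r G' \<alpha> j'"
proof -
  have "map (\<lambda>k. G k (j k)) [Suc a..<d + 1] = map (\<lambda>k. G' k (j' k)) [Suc a..<d + 1]"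
    using assms by (auto simp del: upt_Suc)
  then show ?thesis
    unfolding tt_entry_def by (simp only:)
qed

text \<open>Since \<open>Suc a \<le> k\<close>, the contraction over \<open>\<alpha>\<close> and
  mode \<open>Suc a\<close> acts only on the row side of the \<open>k\<close>-th unfolding: it
  changes the factors \<open>f\<close> and keeps the factors \<open>g\<close>.\<close>

lemma unfolding_rank_le_compress:
  assumes "unfolding_rank_le k r Z" "Suc a \<le> k"
  shows "unfolding_rank_le k r (\<lambda>m j. \<Sum>x\<in>A. h m x * Z (fst x) (j(Suc a := snd x)))"
proof -
  obtain f g where Z: "\<And>\<alpha> j. Z \<alpha> j
      = (\<Sum>m<r. f m \<alpha> (restrict j {..k}) * g m (restrict j {k<..}))"
    using assms(1) unfolding unfolding_rank_le_def by blast
  have low: "restrict (j(Suc a := i)) {..k} = (restrict j {..k})(Suc a := i)"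
    and high: "restrict (j(Suc a := i)) {k<..} = restrict j {k<..}" for j :: "nat \<Rightarrow> nat" and i
    using assms(2) by (auto simp: restrict_def)
  show ?thesis
    unfolding unfolding_rank_le_def
  proof (intro exI allI)
    fix \<alpha> j
    show "(\<Sum>x\<in>A. h \<alpha> x * Z (fst x) (j(Suc a := snd x)))
      = (\<Sum>m<r. (\<Sum>x\<in>A. h \<alpha> x * f m (fst x) ((restrict j {..k})(Suc a := snd x)))
          * g m (restrict j {k<..}))"
      unfolding Z low high
      by (simp add: sum_distrib_left sum_distrib_right mult.assoc) (rule sum.swap)
  qed
qed

text \<open>Separating mode \<open>k\<close> costs at most \<open>e k\<close>: nothing if
  \<open>r k\<close> is the full number of rows, otherwise no more than the error of the given
  \<open>Z\<close>. \<open>X\<close> is generalised because the induction hypothesis is applied to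
  the compressed tensor.\<close>

lemma tt_approximation:
  fixes X :: "nat \<Rightarrow> tensor" and e :: "nat \<Rightarrow> real"
  assumes "a \<le> d - 1" "1 \<le> d" and rd: "r d = 1"
    and e: "\<And>k. 0 \<le> e k"
    and "\<And>k. a < k \<Longrightarrow> k < d \<Longrightarrow> r k = n k * r (k - 1) \<or>
          (\<exists>Z. unfolding_rank_le k (r k) Z \<and>
            (\<Sum>\<alpha><r a. \<Sum>j\<in>tail_indices a d n. (cmod (X \<alpha> j - Z \<alpha> j))\<^sup>2) \<le> e k)"
  shows "\<exists>G. (\<forall>k\<in>{Suc a..d}. \<forall>i. G k i \<in> carrier_mat (r (k - 1)) (r k)) \<and>
          (\<Sum>\<alpha><r a. \<Sum>j\<in>tail_indices a d n. (cmod (X \<alpha> j - tt_entry a d r G \<alpha> j))\<^sup>2)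
            \<le> (\<Sum>k = Suc a..<d. e k)"
  using assms(1,5)
proof (induction arbitrary: X rule: inc_induct)
  case base
  \<comment> \<open>With one mode left, \<open>X\<close> itself is the last core. The function
    \<open>(\<lambda>_. undefined)(d := i)\<close> is the only extensional index on
    \<open>{d}\<close> with value \<open>i\<close>.\<close>
  define G where "G k i = Matrix.mat (r (d - 1)) (r d)
    (\<lambda>(\<alpha>, _). X \<alpha> ((\<lambda>_. undefined)(d := i)))" for k :: nat and i
  have d: "Suc (d - 1) = d" using assms(2) by simp
  have "tt_entry (d - 1) d r G \<alpha> j = X \<alpha> j"
    if "\<alpha> < r (d - 1)" and j: "j \<in> tail_indices (d - 1) d n" for \<alpha> j
  proof -
    have "j = (\<lambda>_. undefined)(d := j d)"
      using j d by (auto simp: PiE_iff extensional_def)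
    then have G: "G d (j d) $$ (\<alpha>, 0) = X \<alpha> j"
      using that(1) rd by (simp add: G_def)
    have "tt_entry (d - 1) d r G \<alpha> j = (G d (j d) * 1\<^sub>m (r d)) $$ (\<alpha>, 0)"
      unfolding tt_entry_def d by simp
    then show ?thesis
      using G by (simp add: G_def)
  qed
  then have "(\<Sum>\<alpha><r (d - 1). \<Sum>j\<in>tail_indices (d - 1) d n.
      (cmod (X \<alpha> j - tt_entry (d - 1) d r G \<alpha> j))\<^sup>2) = 0"
    by simp
  moreover have "\<forall>k\<in>{Suc (d - 1)..d}. \<forall>i. G k i \<in> carrier_mat (r (k - 1)) (r k)"
    unfolding d by (simp add: G_def)
  ultimately show ?case
    using e by (intro exI[of _ G] conjI) (auto intro: sum_nonneg)
next
  case (step a)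
  have ad: "a < d" "Suc a < d" using step.hyps by auto
  \<comment> \<open>\<open>A\<close> indexes the rows of the current unfolding, pairing the
    compressed row index with the next mode; \<open>?slice X j\<close> is its column
    \<open>j\<close>.\<close>
  define A where "A = {..<r a} \<times> {..<n (Suc a)}"
  let ?J = "tail_indices (Suc a) d n"
  let ?R = "r (Suc a)"
  let ?slice = "\<lambda>(X :: nat \<Rightarrow> tensor) j (x :: nat \<times> nat). X (fst x) (j(Suc a := snd x))"
  have finA: "finite A" by (simp add: A_def)
  have total: "(\<Sum>\<alpha><r a. \<Sum>j\<in>tail_indices a d n. (cmod (X \<alpha> j - Z \<alpha> j))\<^sup>2)
      = (\<Sum>j\<in>?J. norm2_on A (\<lambda>x. ?slice X j x - ?slice Z j x))" for X Z :: "nat \<Rightarrow> tensor"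
  proof -
    have "(\<Sum>\<alpha><r a. \<Sum>j\<in>tail_indices a d n. (cmod (X \<alpha> j - Z \<alpha> j))\<^sup>2)
      = (\<Sum>x\<in>A. \<Sum>j\<in>?J. (cmod (?slice X j x - ?slice Z j x))\<^sup>2)"
      unfolding sum_tail_indices[OF ad(1)] A_def
      by (subst sum.cartesian_product) (simp add: case_prod_unfold)
    then show ?thesis
      unfolding norm2_on_def by (subst sum.swap) simp
  qed
  \<comment> \<open>Both alternatives are brought to one form: \<open>?R\<close> column vectors
    \<open>F m\<close> with coefficients \<open>g m j\<close>.\<close>
  obtain F g where Fg: "(\<Sum>j\<in>?J. norm2_on A (\<lambda>x. ?slice X j x - (\<Sum>m<?R. g m j * F m x))) \<le> e (Suc a)"

  proof -
    consider "r (Suc a) = n (Suc a) * r a"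
      | Z where "unfolding_rank_le (Suc a) ?R Z"
        "(\<Sum>\<alpha><r a. \<Sum>j\<in>tail_indices a d n. (cmod (X \<alpha> j - Z \<alpha> j))\<^sup>2) \<le> e (Suc a)"
      using step.prems[of "Suc a"] ad by auto
    then show ?thesis
    proof cases
      case 1
      then have "card A = ?R"
        by (simp add: A_def mult.commute)
      \<comment> \<open>At full rank the \<open>F m\<close> are the unit vectors of
        \<open>A\<close>, enumerated by \<open>h\<close>, and the error is 0.\<close>
      then obtain h where h: "bij_betw h {..<?R} A"
        using ex_bij_betw_nat_finite[OF finA] by (metis atLeast0LessThan)
      have "?slice X j x = (\<Sum>m<?R. ?slice X j (h m) * of_bool (x = h m))" if "x \<in> A" for x j
      proof -
        have "(\<Sum>m<?R. ?slice X j (h m) * of_bool (x = h m))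
            = (\<Sum>y\<in>A. ?slice X j y * of_bool (x = y))"
          by (rule sum.reindex_bij_betw[OF h])
        then show ?thesis
          using that finA by simp
      qed
      then have "norm2_on A (\<lambda>x. ?slice X j x - (\<Sum>m<?R. ?slice X j (h m) * of_bool (x = h m))) = 0" for j
        unfolding norm2_on_def by (intro sum.neutral) auto
      then show ?thesis
        using e[of "Suc a"] that[of "\<lambda>m j. ?slice X j (h m)" "\<lambda>m x. of_bool (x = h m)"] by simp
    next
      case 2
      then obtain f g where Z: "\<And>\<alpha> j. Z \<alpha> j
          = (\<Sum>m<?R. f m \<alpha> (restrict j {..Suc a}) * g m (restrict j {Suc a<..}))"
        unfolding unfolding_rank_le_def by blast
      \<comment> \<open>A tail index is \<open>undefined\<close> up to mode \<open>Suc a\<close>, so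
        after the update the row factor depends on \<open>x\<close> alone.\<close>
      have low: "restrict (j(Suc a := i)) {..Suc a} = (\<lambda>_. undefined)(Suc a := i)"
        and high: "restrict (j(Suc a := i)) {Suc a<..} = restrict j {Suc a<..}"
        if "j \<in> ?J" for j i
        using that by (auto simp: PiE_iff extensional_def restrict_def)
      have "?slice Z j x = (\<Sum>m<?R. g m (restrict j {Suc a<..}) *
          f m (fst x) ((\<lambda>_. undefined)(Suc a := snd x)))" if "j \<in> ?J" for j x
        unfolding Z low[OF that] high[OF that] by (simp add: mult.commute)
      then show ?thesis
        using 2(2) that[of "\<lambda>m j. g m (restrict j {Suc a<..})"
            "\<lambda>m x. f m (fst x) ((\<lambda>_. undefined)(Suc a := snd x))"]
        unfolding total by simp
    qed
  qed
  obtain u where u: "orthonormal_or_zero A ?R u"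
    and span: "\<And>m x. m < ?R \<Longrightarrow> x \<in> A \<Longrightarrow> F m x = proj_on A ?R u (F m) x"
    using gram_schmidt[OF finA, of ?R F] by blast
  \<comment> \<open>The compressed tensor: coefficients of the columns of \<open>X\<close> with
    respect to the family \<open>u\<close>.\<close>
  define X' :: "nat \<Rightarrow> tensor" where "X' m j = cinner_on A (?slice X j) (u m)" for m j
  have "r k = n k * r (k - 1) \<or>
      (\<exists>Z. unfolding_rank_le k (r k) Z \<and>
        (\<Sum>\<alpha><r (Suc a). \<Sum>j\<in>?J. (cmod (X' \<alpha> j - Z \<alpha> j))\<^sup>2) \<le> e k)"
    if k: "Suc a < k" "k < d" for k
  proof -
    have "\<exists>Z. unfolding_rank_le k (r k) Z \<and>
        (\<Sum>\<alpha><r (Suc a). \<Sum>j\<in>?J. (cmod (X' \<alpha> j - Z \<alpha> j))\<^sup>2) \<le> e k"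
      if Z: "unfolding_rank_le k (r k) Z"
        "(\<Sum>\<alpha><r a. \<Sum>j\<in>tail_indices a d n. (cmod (X \<alpha> j - Z \<alpha> j))\<^sup>2) \<le> e k" for Z
    proof (intro exI conjI)
      \<comment> \<open>The approximant for a later mode is compressed by the same \<open>u\<close>;
        Bessel's inequality shows that its error does not grow.\<close>
      show "unfolding_rank_le k (r k) (\<lambda>m j. \<Sum>x\<in>A. cnj (u m x) * Z (fst x) (j(Suc a := snd x)))"
        using Z(1) k by (intro unfolding_rank_le_compress) auto
      have "(\<Sum>m<?R. (cmod (X' m j - (\<Sum>x\<in>A. cnj (u m x) * Z (fst x) (j(Suc a := snd x)))))\<^sup>2)
          \<le> norm2_on A (\<lambda>x. ?slice X j x - ?slice Z j x)" for j
        using bessel[OF finA u, of "\<lambda>x. ?slice X j x - ?slice Z j x"]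
        by (simp add: X'_def cinner_on_def sum_subtractf algebra_simps)
      then have "(\<Sum>j\<in>?J. \<Sum>m<?R. (cmod (X' m j - (\<Sum>x\<in>A. cnj (u m x) * Z (fst x) (j(Suc a := snd x)))))\<^sup>2)
          \<le> (\<Sum>j\<in>?J. norm2_on A (\<lambda>x. ?slice X j x - ?slice Z j x))"
        by (rule sum_mono)
      also have "\<dots> \<le> e k"
        using Z(2) unfolding total .
      finally show "(\<Sum>m<?R. \<Sum>j\<in>?J. (cmod (X' m j - (\<Sum>x\<in>A. cnj (u m x) * Z (fst x) (j(Suc a := snd x)))))\<^sup>2)
          \<le> e k"
        by (subst sum.swap)
    qed
    then show ?thesis
      using step.prems[of k] k by auto
  qed
  from step.IH[OF this] obtain G where
    G: "\<And>k i. k \<in> {Suc (Suc a)..d} \<Longrightarrow> G k i \<in> carrier_mat (r (k - 1)) (r k)"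
    and G_err: "(\<Sum>m<?R. \<Sum>j\<in>?J. (cmod (X' m j - tt_entry (Suc a) d r G m j))\<^sup>2)
      \<le> (\<Sum>k = Suc (Suc a)..<d. e k)"
    by blast
  \<comment> \<open>The new core lists the vectors \<open>u m\<close>, the pair in \<open>A\<close>
    being read as row \<open>\<alpha>\<close> of slice \<open>i\<close>.\<close>
  define G' where "G' = G(Suc a := (\<lambda>i. Matrix.mat (r a) ?R (\<lambda>(\<alpha>, m). u m (\<alpha>, i))))"
  have G': "G' k i \<in> carrier_mat (r (k - 1)) (r k)" if "k \<in> {Suc a..d}" for k i
    using that G by (cases "k = Suc a") (auto simp: G'_def)
  have slice: "?slice (tt_entry a d r G') j x = (\<Sum>m<?R. tt_entry (Suc a) d r G m j * u m x)"
    if "x \<in> A" for j x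
  proof -
    have "tt_entry (Suc a) d r G' m (j(Suc a := snd x)) = tt_entry (Suc a) d r G m j" for m
      by (rule tt_entry_cong) (simp add: G'_def)
    moreover have "G' (Suc a) (snd x) $$ (fst x, m) = u m x" if "m < ?R" for m
      using that \<open>x \<in> A\<close> by (auto simp: G'_def A_def)
    ultimately show ?thesis
      using that G' ad rd by (subst tt_entry_Suc) (auto simp: A_def mult.commute)
  qed
  have "norm2_on A (\<lambda>x. ?slice X j x - ?slice (tt_entry a d r G') j x)
      \<le> norm2_on A (\<lambda>x. ?slice X j x - (\<Sum>m<?R. g m j * F m x))
        + (\<Sum>m<?R. (cmod (X' m j - tt_entry (Suc a) d r G m j))\<^sup>2)" for j
  proof -
    \<comment> \<open>Combinations of the \<open>F m\<close> stay in the span, so they can play the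
      part of \<open>z\<close> in \<open>approx_by_combination\<close>.\<close>
    have "(\<Sum>m<?R. g m j * F m x) = proj_on A ?R u (\<lambda>x. \<Sum>m<?R. g m j * F m x) x" if "x \<in> A" for x
    proof -
      have "(\<Sum>m<?R. g m j * F m x) = (\<Sum>m<?R. g m j * proj_on A ?R u (F m) x)"
        using span that by simp
      also have "\<dots> = proj_on A ?R u (\<lambda>x. \<Sum>m<?R. g m j * F m x) x"
        unfolding proj_on_def cinner_on_sum_left
        by (simp add: sum_distrib_left sum_distrib_right mult.assoc) (rule sum.swap)
      finally show ?thesis .
    qed
    from approx_by_combination[OF finA u this, where v = "?slice X j"
        and y = "\<lambda>m. tt_entry (Suc a) d r G m j"]
    show ?thesis
      using slice by (simp add: X'_def norm2_on_def)
  qed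
  then have "(\<Sum>\<alpha><r a. \<Sum>j\<in>tail_indices a d n. (cmod (X \<alpha> j - tt_entry a d r G' \<alpha> j))\<^sup>2)
      \<le> (\<Sum>j\<in>?J. norm2_on A (\<lambda>x. ?slice X j x - (\<Sum>m<?R. g m j * F m x)))
        + (\<Sum>j\<in>?J. \<Sum>m<?R. (cmod (X' m j - tt_entry (Suc a) d r G m j))\<^sup>2)"
    unfolding total sum.distrib[symmetric] by (intro sum_mono)
  also have "(\<Sum>j\<in>?J. \<Sum>m<?R. (cmod (X' m j - tt_entry (Suc a) d r G m j))\<^sup>2)
      \<le> (\<Sum>k = Suc (Suc a)..<d. e k)"
    using G_err by (subst sum.swap)
  also note Fg
  also have "e (Suc a) + (\<Sum>k = Suc (Suc a)..<d. e k) = (\<Sum>k = Suc a..<d. e k)"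
    using ad by (simp add: sum.atLeast_Suc_lessThan)
  finally show ?case
    using G' by (intro exI[of _ G']) auto
qed

section \<open>Low-rank approximation of Cauchy matrices by geometric series\<close>

text \<open>The sum is minus the truncated expansion of \<open>1 / (x - y)\<close> in powers of
  \<open>x / y\<close>, which explains the plus sign. The remainder is a multiple of the value
  itself, hence a relative error.\<close>

lemma geometric_remainder:
  fixes x y :: complex
  assumes "y \<noteq> 0" "x \<noteq> y"
  shows "1 / (x - y) + (\<Sum>m<R. x ^ m / y ^ Suc m) = (x / y) ^ R * (1 / (x - y))"
proof (induction R)
  case 0
  show ?case by simp
next
  case (Suc R)
  have "1 / (x - y) + (\<Sum>m<Suc R. x ^ m / y ^ Suc m)
      = (x / y) ^ R * (1 / (x - y)) + x ^ R / y ^ Suc R"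
    using Suc.IH by (simp flip: add.assoc)
  also have "\<dots> = (x / y) ^ R * (1 / (x - y) + 1 / y)"
    by (simp add: power_divide algebra_simps)
  also have "1 / (x - y) + 1 / y = (x / y) * (1 / (x - y))"
    using assms by (simp add: field_simps)
  finally show ?case
    by simp
qed

lemma disk_separates_bounds:
  assumes "disk_separates c D D' A B" "0 < D"
  shows "x \<in> A \<Longrightarrow> cmod (x - c) \<le> D" "y \<in> B \<Longrightarrow> D + D' \<le> cmod (y - c)"
proof -
  show "cmod (x - c) \<le> D" if "x \<in> A"
    using assms(1) that by (auto simp: disk_separates_def dist_norm norm_minus_commute)
  show "D + D' \<le> cmod (y - c)" if y: "y \<in> B"
  proof -
    define \<rho> where "\<rho> = cmod (y - c)"
    have "y \<notin> cball c D"
      using assms(1) y by (auto simp: disk_separates_def)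
    then have \<rho>: "D < \<rho>"
      by (simp add: \<rho>_def dist_norm norm_minus_commute)
    \<comment> \<open>The point where the segment from \<open>c\<close> to \<open>y\<close> leaves
      the disk; its distance from \<open>y\<close> is \<open>\<rho> - D\<close>.\<close>
    define z where "z = c + of_real (D / \<rho>) * (y - c)"
    have "z \<in> cball c D"
      using \<rho> assms(2) by (simp add: z_def dist_norm norm_mult norm_divide flip: \<rho>_def)
    then have "D' \<le> dist y z"
      using assms(1) y by (auto simp: disk_separates_def setdist_le_dist)
    also have "y - z = of_real (1 - D / \<rho>) * (y - c)"
      by (simp add: z_def algebra_simps)
    then have "dist y z = \<bar>1 - D / \<rho>\<bar> * \<rho>"
      unfolding dist_norm by (simp only: norm_mult norm_of_real \<rho>_def)
    also have "\<dots> = \<rho> - D"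
      using \<rho> assms(2) by (simp add: field_simps abs_if)
    finally show ?thesis
      by (simp add: \<rho>_def)
  qed
qed

text \<open>A finite set is compact, and it is disjoint from a closed disk, so the distance is
  positive; \<open>B\<close> must be nonempty since \<open>setdist\<close> to the empty set is
  0.\<close>

lemma disk_separates_gap_pos:
  assumes "disk_separates c D D' A B" "0 < D" "finite B" "B \<noteq> {}"
  shows "0 < D'"
proof -
  have "setdist B (cball c D) \<noteq> 0"
    using assms by (subst setdist_eq_0_compact_closed)
      (auto simp: disk_separates_def finite_imp_compact)
  then show ?thesis
    using assms(1) setdist_pos_le[of B "cball c D"] by (simp add: disk_separates_def less_le)
qed

lemma finite_sums_of_choices:
  fixes f :: "nat \<Rightarrow> nat \<Rightarrow> 'b::comm_monoid_add"
  assumes "finite I"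
  shows "finite {\<Sum>s\<in>I. f s (j s) | j. \<forall>s\<in>I. j s < n s}"
proof (rule finite_subset)
  show "{\<Sum>s\<in>I. f s (j s) | j. \<forall>s\<in>I. j s < n s} \<subseteq> (\<lambda>j. \<Sum>s\<in>I. f s (j s)) ` (\<Pi>\<^sub>E s\<in>I. {..<n s})"
  proof clarify
    fix j assume "\<forall>s\<in>I. j s < n s"
    then have "restrict j I \<in> (\<Pi>\<^sub>E s\<in>I. {..<n s})"
      by auto
    moreover have "(\<Sum>s\<in>I. f s (j s)) = (\<Sum>s\<in>I. f s (restrict j I s))"
      by simp
    ultimately show "(\<Sum>s\<in>I. f s (j s)) \<in> (\<lambda>j. \<Sum>s\<in>I. f s (j s)) ` (\<Pi>\<^sub>E s\<in>I. {..<n s})"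
      by blast
  qed
  show "finite ((\<lambda>j. \<Sum>s\<in>I. f s (j s)) ` (\<Pi>\<^sub>E s\<in>I. {..<n s}))"
    using assms by (intro finite_imageI finite_PiE) auto
qed

lemma finite_P_set: "finite (P_set n lam mu k)"
  unfolding P_set_def using finite_sums_of_choices[of "{1..k}" "\<lambda>s i. mu s i / lam s i" n] by simp

lemma finite_Q_set: "finite (Q_set d n lam mu k)"
proof -
  have "Q_set d n lam mu k
      = uminus ` {\<Sum>s\<in>{k + 1..d}. mu s (j s) / lam s (j s) | j. \<forall>s\<in>{k + 1..d}. j s < n s}"
    unfolding Q_set_def by blast
  then show ?thesis
    using finite_sums_of_choices[of "{k + 1..d}" "\<lambda>s i. mu s i / lam s i" n] by simp
qed

lemma associated_tensor_factor:
  assumes "\<And>s. s \<in> {1..d} \<Longrightarrow> lam s (j s) \<noteq> 0"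
  shows "associated_tensor d lam mu j
    = (\<Prod>s = 1..d. lam s (j s)) * (\<Sum>s = 1..d. mu s (j s) / lam s (j s))"
  unfolding associated_tensor_def sum_distrib_left
proof (rule sum.cong[OF refl])
  fix k assume k: "k \<in> {1..d}"
  have "{1..d} = insert k ({1..<k} \<union> {k + 1..d})"
    using k by auto
  then have "(\<Prod>s = 1..d. lam s (j s))
      = lam k (j k) * ((\<Prod>s = 1..<k. lam s (j s)) * (\<Prod>s = k + 1..d. lam s (j s)))"
    by (simp, subst prod.union_disjoint[symmetric]) auto
  then show "(\<Prod>s = 1..<k. lam s (j s)) * mu k (j k) * (\<Prod>s = k + 1..d. lam s (j s))
      = (\<Prod>s = 1..d. lam s (j s)) * (mu k (j k) / lam k (j k))"
    using assms[OF k] by simp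
qed

lemma hadamard_inverse_split:
  assumes "k \<le> d" "\<And>s. s \<in> {1..d} \<Longrightarrow> lam s (j s) \<noteq> 0"
  shows "hadamard_inverse (associated_tensor d lam mu) j
    = inverse (\<Prod>s = 1..k. lam s (j s)) * inverse (\<Prod>s = k + 1..d. lam s (j s))
      * (1 / ((\<Sum>s = 1..k. mu s (j s) / lam s (j s)) - (- (\<Sum>s = k + 1..d. mu s (j s) / lam s (j s)))))"
proof -
  have split: "{1..d} = {1..k} \<union> {k + 1..d}"
    using assms(1) by auto
  have disj: "{1..k} \<inter> {k + 1..d} = {}"
    by auto
  have "(\<Prod>s = 1..d. lam s (j s)) = (\<Prod>s = 1..k. lam s (j s)) * (\<Prod>s = k + 1..d. lam s (j s))"
    unfolding split using disj by (intro prod.union_disjoint) auto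
  moreover have "(\<Sum>s = 1..d. mu s (j s) / lam s (j s))
      = (\<Sum>s = 1..k. mu s (j s) / lam s (j s)) + (\<Sum>s = k + 1..d. mu s (j s) / lam s (j s))"
    unfolding split using disj by (intro sum.union_disjoint) auto
  ultimately show ?thesis
    using associated_tensor_factor[of d lam j mu] assms(2)
    by (simp add: hadamard_inverse_def divide_inverse)
qed

lemma unfolding_rank_le_separated:
  assumes "\<And>m j. f m (restrict j {..k}) = f m j" "\<And>m j. g m (restrict j {k<..}) = g m j"
  shows "unfolding_rank_le k r (\<lambda>_ j. \<Sum>m<r. f m j * g m j)"
  unfolding unfolding_rank_le_def
  by (intro exI[of _ "\<lambda>m _. f m"] exI[of _ g]) (simp add: assms)

text \<open>The set inside the disk supplies the numerator of the geometric ratio, the other set the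
  denominator. The error is relative in each entry, so the rank-one factors \<open>a\<close> and
  \<open>b\<close> do not affect it.\<close>

lemma disk_separated_approximation:
  assumes k: "k \<in> {1..d - 1}" and D: "0 < D"
    and lam: "\<And>k j. k \<in> {1..d} \<Longrightarrow> j < n k \<Longrightarrow> lam k j \<noteq> 0"
    and sep: "disk_separates c D D' (P_set n lam mu k) (Q_set d n lam mu k) \<or>
      disk_separates c D D' (Q_set d n lam mu k) (P_set n lam mu k)"
    and D': "0 < D'"
  shows "\<exists>Z. unfolding_rank_le k R (\<lambda>_. Z) \<and> (\<forall>j\<in>multi_indices d n.
    cmod (hadamard_inverse (associated_tensor d lam mu) j - Z j)
      \<le> (D / (D + D')) ^ R * cmod (hadamard_inverse (associated_tensor d lam mu) j))"
proof -
  let ?H = "hadamard_inverse (associated_tensor d lam mu)"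
  \<comment> \<open>Both nodes are recentred at \<open>c\<close>, which leaves
    \<open>p j - q j\<close> unchanged.\<close>
  define a b p q where "a j = inverse (\<Prod>s = 1..k. lam s (j s))"
    and "b j = inverse (\<Prod>s = k + 1..d. lam s (j s))"
    and "p j = (\<Sum>s = 1..k. mu s (j s) / lam s (j s)) - c"
    and "q j = - (\<Sum>s = k + 1..d. mu s (j s) / lam s (j s)) - c" for j :: "nat \<Rightarrow> nat"
  have low: "a (restrict j {..k}) = a j" "p (restrict j {..k}) = p j" for j
    by (simp_all add: a_def p_def)
  have high: "b (restrict j {k<..}) = b j" "q (restrict j {k<..}) = q j" for j
    by (simp_all add: b_def q_def)
  have H: "?H j = a j * b j * (1 / (p j - q j))" if "j \<in> multi_indices d n" for j
  proof -
    have "lam s (j s) \<noteq> 0" if "s \<in> {1..d}" for s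
    proof (rule lam[OF that])
      show "j s < n s"
        using \<open>j \<in> _\<close> that by (auto simp: multi_indices_def PiE_iff)
    qed
    then show ?thesis
      using k by (subst hadamard_inverse_split[of k]) (auto simp: a_def b_def p_def q_def)
  qed
  have P: "p j + c \<in> P_set n lam mu k" and Q: "q j + c \<in> Q_set d n lam mu k"
    if "j \<in> multi_indices d n" for j
    using that k unfolding P_set_def Q_set_def p_def q_def multi_indices_def
    by (auto intro!: exI[of _ j])
  have err: "cmod ((x / y) ^ R * h) \<le> (D / (D + D')) ^ R * cmod h"
    if "cmod x \<le> D" "D + D' \<le> cmod y" for x y h
  proof -
    have "cmod x / cmod y \<le> D / (D + D')"
      using that D D' by (intro frac_le) auto
    then show ?thesis
      by (simp add: norm_mult norm_power norm_divide mult_right_mono power_mono)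
  qed
  from sep show ?thesis
  proof
    assume s: "disk_separates c D D' (P_set n lam mu k) (Q_set d n lam mu k)"
    let ?Z = "\<lambda>j. \<Sum>m<R. (- (a j * p j ^ m)) * (b j / q j ^ Suc m)"
    have "cmod (?H j - ?Z j) \<le> (D / (D + D')) ^ R * cmod (?H j)" if j: "j \<in> multi_indices d n" for j
    proof -
      have bounds: "cmod (p j) \<le> D" "D + D' \<le> cmod (q j)"
        using disk_separates_bounds[OF s D] P[OF j] Q[OF j] by fastforce+
      then have "q j \<noteq> 0" "p j \<noteq> q j"
        using D D' by auto
      have "?H j - ?Z j = a j * b j * (1 / (p j - q j) + (\<Sum>m<R. p j ^ m / q j ^ Suc m))"
        unfolding H[OF j] by (simp add: sum_negf distrib_left sum_distrib_left mult_ac)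
      also have "\<dots> = (p j / q j) ^ R * ?H j"
        unfolding H[OF j] geometric_remainder[OF \<open>q j \<noteq> 0\<close> \<open>p j \<noteq> q j\<close>] by (simp add: mult_ac)
      finally show ?thesis
        using err[OF bounds] by simp
    qed
    moreover have "unfolding_rank_le k R (\<lambda>_. ?Z)"
      by (rule unfolding_rank_le_separated) (simp_all add: low high)
    ultimately show ?thesis
      by blast
  next
    assume s: "disk_separates c D D' (Q_set d n lam mu k) (P_set n lam mu k)"
    \<comment> \<open>With \<open>q\<close> inside the disk, \<open>1 / (p - q)\<close> expands in
      powers of \<open>q / p\<close> with positive sign, in contrast to the first case.\<close>
    let ?Z = "\<lambda>j. \<Sum>m<R. (a j / p j ^ Suc m) * (b j * q j ^ m)"
    have "cmod (?H j - ?Z j) \<le> (D / (D + D')) ^ R * cmod (?H j)" if j: "j \<in> multi_indices d n" for j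
    proof -
      have bounds: "cmod (q j) \<le> D" "D + D' \<le> cmod (p j)"
        using disk_separates_bounds[OF s D] P[OF j] Q[OF j] by fastforce+
      then have "p j \<noteq> 0" "q j \<noteq> p j"
        using D D' by auto
      have H': "?H j = - (a j * b j * (1 / (q j - p j)))"
        unfolding H[OF j] using \<open>q j \<noteq> p j\<close> by (simp add: field_simps)
      have "?H j - ?Z j = - (a j * b j * (1 / (q j - p j) + (\<Sum>m<R. q j ^ m / p j ^ Suc m)))"
        unfolding H' by (simp add: distrib_left sum_distrib_left mult_ac)
      also have "\<dots> = (q j / p j) ^ R * ?H j"
        unfolding H' geometric_remainder[OF \<open>p j \<noteq> 0\<close> \<open>q j \<noteq> p j\<close>] by (simp add: mult_ac)
      finally show ?thesis
        using err[OF bounds] by simp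
    qed
    moreover have "unfolding_rank_le k R (\<lambda>_. ?Z)"
      by (rule unfolding_rank_le_separated) (simp_all add: low high)
    ultimately show ?thesis
      by blast
  qed
qed

text \<open>One term per column of the unfolding: \<open>f m\<close> is the column with tail
  \<open>h m\<close>, and \<open>g m\<close> is the indicator of that tail. This settles the case
  where the rank equals the number of columns.\<close>

lemma unfolding_rank_le_full:
  fixes X :: tensor
  shows "\<exists>Z. unfolding_rank_le k (\<Prod>s = k + 1..d. n s) (\<lambda>_. Z) \<and> (\<forall>j\<in>multi_indices d n. Z j = X j)"
proof -
  let ?R = "\<Prod>s = k + 1..d. n s"
  have "card (tail_indices k d n) = ?R"
    by (simp add: card_PiE)
  then obtain h where h: "bij_betw h {..<?R} (tail_indices k d n)"
    using ex_bij_betw_nat_finite[OF finite_tail_indices] by (metis atLeast0LessThan)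
  define f g where "f m j = X (\<lambda>s. if s \<le> k then j s else h m s)"
    and "g m j = (of_bool (restrict j {Suc k..d} = h m) :: complex)" for m :: nat and j :: "nat \<Rightarrow> nat"
  have "f m (restrict j {..k}) = f m j" for m j
    by (simp add: f_def cong: if_cong)
  moreover have "g m (restrict j {k<..}) = g m j" for m j
  proof -
    have "{k<..} \<inter> {Suc k..d} = {Suc k..d}"
      by auto
    then show ?thesis
      by (simp add: g_def)
  qed
  ultimately have "unfolding_rank_le k ?R (\<lambda>_ j. \<Sum>m<?R. f m j * g m j)"
    by (rule unfolding_rank_le_separated)
  moreover have "(\<Sum>m<?R. f m j * g m j) = X j" if j: "j \<in> multi_indices d n" for j
  proof -
    define t where "t = restrict j {Suc k..d}"
    have tail: "t \<in> tail_indices k d n"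
      using j by (auto simp: multi_indices_def t_def)
    have "(\<Sum>m<?R. f m j * g m j) = (\<Sum>i\<in>tail_indices k d n.
        X (\<lambda>s. if s \<le> k then j s else i s) * of_bool (t = i))"
      unfolding f_def g_def t_def by (rule sum.reindex_bij_betw[OF h])
    also have "\<dots> = (\<Sum>i\<in>tail_indices k d n. if t = i then X (\<lambda>s. if s \<le> k then j s else i s) else 0)"
      by (intro sum.cong) auto
    also have "\<dots> = X (\<lambda>s. if s \<le> k then j s else t s)"
      by (simp only: sum.delta'[OF finite_tail_indices] tail if_True)
    also have "(\<lambda>s. if s \<le> k then j s else t s) = j"
      using j by (auto simp: t_def multi_indices_def PiE_iff extensional_def)
    finally show ?thesis .
  qed
  ultimately show ?thesis
    by blast
qed

section \<open>Choice of the ranks and assembly of the bound\<close>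

text \<open>With \<open>b = t^2\<close> the argument of the logarithm lies strictly between
  \<open>b ^ N\<close> and 1, so the logarithm to base \<open>b < 1\<close> lies strictly between 0
  and \<open>N\<close>.\<close>

lemma truncation_rank:
  fixes t \<epsilon> :: real and d N R :: nat
  assumes t: "0 < t" "t < 1" and \<epsilon>: "0 < \<epsilon>" "\<epsilon> < 1" and "2 \<le> d" "1 \<le> N"
    and R: "R = nat \<lceil>log (t\<^sup>2) ((1 - t\<^sup>2) * \<epsilon>\<^sup>2 / (real d - 1) + t ^ (2 * N))\<rceil>"
  shows "1 \<le> R" "R \<le> N"
    and "int R = \<lceil>log (t\<^sup>2) ((1 - t\<^sup>2) * \<epsilon>\<^sup>2 / (real d - 1) + t ^ (2 * N))\<rceil>"
    and "R < N \<Longrightarrow> (t ^ R)\<^sup>2 \<le> \<epsilon>\<^sup>2 / (real d - 1)"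
proof -
  define b where "b = t\<^sup>2"
  define \<delta> where "\<delta> = \<epsilon>\<^sup>2 / (real d - 1)"
  define x where "x = (1 - b) * \<delta> + b ^ N"
  have b: "0 < b" "b < 1"
    using t by (simp_all add: b_def power_less_one_iff)
  have x_eq: "(1 - t\<^sup>2) * \<epsilon>\<^sup>2 / (real d - 1) + t ^ (2 * N) = x"
    by (simp add: x_def b_def \<delta>_def power_mult)
  have "\<epsilon>\<^sup>2 < 1"
    using \<epsilon> by (simp add: power_less_one_iff)
  moreover have "\<epsilon>\<^sup>2 / (real d - 1) \<le> \<epsilon>\<^sup>2 / 1"
    using \<open>2 \<le> d\<close> by (intro divide_left_mono) auto
  ultimately have \<delta>: "0 < \<delta>" "\<delta> < 1"
    using \<epsilon> \<open>2 \<le> d\<close> by (auto simp: \<delta>_def)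
  have "b ^ N \<le> b"
    using b \<open>1 \<le> N\<close> power_decreasing[of 1 N b] by simp
  moreover have "(1 - b) * \<delta> < 1 - b"
    using \<delta> b by simp
  ultimately have x1: "x < 1"
    unfolding x_def by linarith
  have xN: "b ^ N < x"
    using b \<delta> by (simp add: x_def)
  have "0 < b ^ N"
    using b by simp
  then have "0 < x"
    using xN by linarith
  have log_mono: "log b v < log b u \<longleftrightarrow> u < v" if "0 < u" "0 < v" for u v
    using that b by (simp add: log_def divide_less_cancel)
  have "log b x < log b (b ^ N)"
    using xN \<open>0 < x\<close> \<open>0 < b ^ N\<close> by (simp add: log_mono)
  then have logN: "log b x < N"
    using b by (simp add: log_nat_power)
  have "log b 1 < log b x"
    using x1 \<open>0 < x\<close> by (subst log_mono) auto
  then have log0: "0 < log b x"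
    by simp
  have R': "R = nat \<lceil>log b x\<rceil>"
    using R unfolding x_eq by (simp add: b_def)
  then have intR: "int R = \<lceil>log b x\<rceil>"
    using log0 by simp
  then show "int R = \<lceil>log (t\<^sup>2) ((1 - t\<^sup>2) * \<epsilon>\<^sup>2 / (real d - 1) + t ^ (2 * N))\<rceil>"
    unfolding x_eq by (simp add: b_def)
  have "0 < \<lceil>log b x\<rceil>" "\<lceil>log b x\<rceil> \<le> int N"
    using log0 logN by (simp_all add: ceiling_le_iff)
  then show "1 \<le> R" "R \<le> N"
    using intR by linarith+
  show "(t ^ R)\<^sup>2 \<le> \<epsilon>\<^sup>2 / (real d - 1)" if "R < N"
  proof -
    have "log b x \<le> real R"
      using intR le_of_int_ceiling[of "log b x"] by linarith
    then have "log b x \<le> log b (b ^ R)"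
      using b by (simp add: log_nat_power)
    then have "b ^ R \<le> x"
      using log_mono[of x "b ^ R"] \<open>0 < x\<close> b by (simp add: not_less flip: not_less)
    \<comment> \<open>This turns \<open>b ^ R \<le> x\<close> into
      \<open>b ^ R \<le> (1 - b) * \<delta> + b * b ^ R\<close>; the factor \<open>1 - b\<close>
      then cancels.\<close>
    moreover have "b ^ N \<le> b ^ Suc R"
      using b that by (intro power_decreasing) auto
    ultimately have "(1 - b) * b ^ R \<le> (1 - b) * \<delta>"
      by (simp add: x_def algebra_simps)
    then have "b ^ R \<le> \<delta>"
      using b by simp
    then show ?thesis
      by (simp add: b_def \<delta>_def power_mult[symmetric] mult.commute)
  qed
qed

theorem corollary4p7:
  fixes d :: nat
    and n :: "nat \<Rightarrow> nat"
    and M S U V :: "nat \<Rightarrow> complex mat"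
    and lam mu :: "nat \<Rightarrow> nat \<Rightarrow> complex"
    and c :: "nat \<Rightarrow> complex"
    and D D' \<tau> :: "nat \<Rightarrow> real"
    and \<epsilon> :: real
  assumes "2 \<le> d"
    and "\<And>k. k \<in> {1..d} \<Longrightarrow> 1 \<le> n k"
    and "\<And>k. k \<in> {1..d} \<Longrightarrow>
           joint_diagonalization (n k) (U k) (V k) (M k) (S k) (lam k) (mu k)"
    and "invertible_mat (structured_matrix d n M S)"
    and "\<And>k j. k \<in> {1..d} \<Longrightarrow> j < n k \<Longrightarrow> lam k j \<noteq> 0"
    and "\<And>k. k \<in> {1..d - 1} \<Longrightarrow> 0 < D k"
    and "\<And>k. k \<in> {1..d - 1} \<Longrightarrow>
           disk_separates (c k) (D k) (D' k) (P_set n lam mu k) (Q_set d n lam mu k) \<or>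
           disk_separates (c k) (D k) (D' k) (Q_set d n lam mu k) (P_set n lam mu k)"
    and "\<And>k. k \<in> {1..d - 1} \<Longrightarrow> \<tau> k = D k / (D k + D' k)"
    and "0 < \<epsilon>" and "\<epsilon> < 1"
  shows "\<exists>Y \<in> {Y :: tensor.
             frob_norm d n (\<lambda>j. hadamard_inverse (associated_tensor d lam mu) j - Y j)
               \<le> \<epsilon> * frob_norm d n (hadamard_inverse (associated_tensor d lam mu))}.
         \<exists>r :: nat \<Rightarrow> nat. has_tt_ranks d n r Y \<and>
           (\<forall>k \<in> {1..d - 1}.
              let N = min (n k * r (k - 1)) (\<Prod>s = k + 1..d. n s) in
              int (r k) \<le> \<lceil>log ((\<tau> k)\<^sup>2)
                ((1 - (\<tau> k)\<^sup>2) * \<epsilon>\<^sup>2 / (real d - 1) + (\<tau> k) ^ (2 * N))\<rceil>)"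
proof -
  let ?H = "hadamard_inverse (associated_tensor d lam mu)"
  have multi: "multi_indices d n = tail_indices 0 d n"
    by (simp add: multi_indices_def)
  have D': "0 < D' k" if k: "k \<in> {1..d - 1}" for k
  proof -
    have "0 < n s" if "s \<in> {1..d}" for s
      using assms(2)[OF that] by simp
    then have "P_set n lam mu k \<noteq> {}" "Q_set d n lam mu k \<noteq> {}"
      using k by (auto simp: P_set_def Q_set_def intro!: exI[of _ "\<lambda>_. 0"])
    then show ?thesis
      using assms(7)[OF k] disk_separates_gap_pos[OF _ assms(6)[OF k]] finite_P_set finite_Q_set
      by metis
  qed
  have \<tau>: "0 < \<tau> k" "\<tau> k < 1" if "k \<in> {1..d - 1}" for k
    using D'[OF that] assms(6)[OF that] by (simp_all add: assms(8)[OF that])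
  define N where "N k s = min (n k * s) (\<Prod>s = k + 1..d. n s)" for k s
  define bound where "bound k s = \<lceil>log ((\<tau> k)\<^sup>2)
    ((1 - (\<tau> k)\<^sup>2) * \<epsilon>\<^sup>2 / (real d - 1) + (\<tau> k) ^ (2 * N k s))\<rceil>" for k s
  \<comment> \<open>The ranks are chosen recursively with equality in the bound, because
    \<open>N_k\<close> contains the preceding rank. From index \<open>d\<close> on the value is
    1.\<close>
  define r where "r = rec_nat 1 (\<lambda>k s. if Suc k < d then nat (bound (Suc k) s) else 1)"
  have r0: "r 0 = 1" and rd: "r d = 1"
    using assms(1) by (simp add: r_def, cases d, auto simp: r_def)
  have rk: "r k = nat (bound k (r (k - 1)))" if "k \<in> {1..d - 1}" for k
    using that by (cases k) (auto simp: r_def)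
  have r_trunc: "1 \<le> r k" "r k \<le> N k (r (k - 1))" "int (r k) = bound k (r (k - 1))"
      "r k < N k (r (k - 1)) \<Longrightarrow> (\<tau> k ^ r k)\<^sup>2 \<le> \<epsilon>\<^sup>2 / (real d - 1)"
    if "k \<in> {1..d - 1}" "1 \<le> r (k - 1)" for k
  proof -
    have "0 < (\<Prod>s = k + 1..d. n s)"
      using assms(2) by (intro prod_pos) (fastforce simp: Suc_le_eq)
    moreover have "k \<in> {1..d}"
      using that(1) by auto
    then have "0 < n k"
      using assms(2)[of k] by linarith
    ultimately have "1 \<le> N k (r (k - 1))"
      using that(2) by (simp add: N_def Suc_le_eq)
    note * = truncation_rank[OF \<tau>[OF that(1)] assms(9,10,1) this rk[OF that(1), unfolded bound_def]]
    show "1 \<le> r k" "r k \<le> N k (r (k - 1))" "int (r k) = bound k (r (k - 1))"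
      "r k < N k (r (k - 1)) \<Longrightarrow> (\<tau> k ^ r k)\<^sup>2 \<le> \<epsilon>\<^sup>2 / (real d - 1)"
      using * by (simp_all add: bound_def)
  qed
  have r_pos: "1 \<le> r k" for k
  proof (induction k)
    case 0
    then show ?case by (simp add: r0)
  next
    case (Suc k)
    show ?case
    proof (cases "Suc k < d")
      case True
      then show ?thesis
        using r_trunc(1)[of "Suc k"] Suc.IH by simp
    next
      case False
      then show ?thesis by (simp add: r_def)
    qed
  qed
  \<comment> \<open>Each of the \<open>d - 1\<close> unfoldings receives an equal share of the
    admissible squared error.\<close>
  define e where "e = \<epsilon>\<^sup>2 / (real d - 1) * (\<Sum>j\<in>tail_indices 0 d n. (cmod (?H j))\<^sup>2)"
  have e_nonneg: "0 \<le> e"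
    using assms(1) by (simp add: e_def sum_nonneg)
  have "\<exists>G. (\<forall>k\<in>{Suc 0..d}. \<forall>i. G k i \<in> carrier_mat (r (k - 1)) (r k)) \<and>
      (\<Sum>\<alpha><r 0. \<Sum>j\<in>tail_indices 0 d n. (cmod (?H j - tt_entry 0 d r G \<alpha> j))\<^sup>2)
        \<le> (\<Sum>k = Suc 0..<d. e)"
  proof (rule tt_approximation)
    fix k assume k: "0 < k" "k < d"
    then have k': "k \<in> {1..d - 1}" by auto
    note trunc = r_trunc[OF k' r_pos]
    have "\<exists>Z. unfolding_rank_le k (r k) (\<lambda>_. Z) \<and>
        (\<Sum>j\<in>tail_indices 0 d n. (cmod (?H j - Z j))\<^sup>2) \<le> e" if "r k \<noteq> n k * r (k - 1)"
    proof (cases "r k = (\<Prod>s = k + 1..d. n s)")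
      case True
      then obtain Z where "unfolding_rank_le k (r k) (\<lambda>_. Z)" "\<forall>j\<in>multi_indices d n. Z j = ?H j"
        using unfolding_rank_le_full[of k n d ?H] by auto
      then show ?thesis
        using e_nonneg by (intro exI[of _ Z]) (simp add: multi)
    next
      case False
      \<comment> \<open>\<open>r k\<close> is at most the minimum \<open>N\<close> and differs from
        both of its arguments, so the geometric series bound applies.\<close>
      then have less: "r k < N k (r (k - 1))"
        using trunc(2) that by (auto simp: N_def min_def split: if_splits)
      obtain Z where Z: "unfolding_rank_le k (r k) (\<lambda>_. Z)"
        "\<forall>j\<in>multi_indices d n. cmod (?H j - Z j) \<le> \<tau> k ^ r k * cmod (?H j)"
        using disk_separated_approximation[OF k' assms(6)[OF k'] assms(5) assms(7)[OF k'] D'[OF k'], of "r k"]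
        unfolding assms(8)[OF k'] by blast
      have "(\<Sum>j\<in>tail_indices 0 d n. (cmod (?H j - Z j))\<^sup>2)
          \<le> (\<Sum>j\<in>tail_indices 0 d n. \<epsilon>\<^sup>2 / (real d - 1) * (cmod (?H j))\<^sup>2)"
      proof (rule sum_mono)
        fix j assume "j \<in> tail_indices 0 d n"
        then have "(cmod (?H j - Z j))\<^sup>2 \<le> (\<tau> k ^ r k * cmod (?H j))\<^sup>2"
          using Z(2) by (intro power_mono) (auto simp: multi)
        also have "\<dots> \<le> \<epsilon>\<^sup>2 / (real d - 1) * (cmod (?H j))\<^sup>2"
          unfolding power_mult_distrib using trunc(4)[OF less] by (intro mult_right_mono) auto
        finally show "(cmod (?H j - Z j))\<^sup>2 \<le> \<epsilon>\<^sup>2 / (real d - 1) * (cmod (?H j))\<^sup>2" .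
      qed
      then show ?thesis
        using Z(1) by (auto simp: e_def sum_distrib_left)
    qed
    then show "r k = n k * r (k - 1) \<or> (\<exists>Z. unfolding_rank_le k (r k) Z \<and>
        (\<Sum>\<alpha><r 0. \<Sum>j\<in>tail_indices 0 d n. (cmod (?H j - Z \<alpha> j))\<^sup>2) \<le> e)"
      by (fastforce simp: r0)
  qed (use assms(1) rd e_nonneg in auto)
  then obtain G where G: "\<And>k i. k \<in> {Suc 0..d} \<Longrightarrow> G k i \<in> carrier_mat (r (k - 1)) (r k)"
    and G_err: "(\<Sum>\<alpha><r 0. \<Sum>j\<in>tail_indices 0 d n. (cmod (?H j - tt_entry 0 d r G \<alpha> j))\<^sup>2)
      \<le> (\<Sum>k = Suc 0..<d. e)"
    by blast
  \<comment> \<open>As \<open>r 0 = 1\<close>, only row 0 is left, and the error budget consists of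
    \<open>d - 1\<close> copies of \<open>e\<close>.\<close>
  have err: "(\<Sum>j\<in>multi_indices d n. (cmod (?H j - tt_entry 0 d r G 0 j))\<^sup>2) \<le> real (d - 1) * e"
    using G_err by (simp add: r0 multi)
  have "real (d - 1) * e = \<epsilon>\<^sup>2 * (\<Sum>j\<in>multi_indices d n. (cmod (?H j))\<^sup>2)"
    using assms(1) by (simp add: e_def multi of_nat_diff)
  then have "frob_norm d n (\<lambda>j. ?H j - tt_entry 0 d r G 0 j)
      \<le> sqrt (\<epsilon>\<^sup>2 * (\<Sum>j\<in>multi_indices d n. (cmod (?H j))\<^sup>2))"
    unfolding frob_norm_def using err by simp
  also have "\<dots> = \<epsilon> * frob_norm d n ?H"
    using assms(9) by (simp add: frob_norm_def real_sqrt_mult)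
  finally have "frob_norm d n (\<lambda>j. ?H j - tt_entry 0 d r G 0 j) \<le> \<epsilon> * frob_norm d n ?H" .
  moreover have "has_tt_ranks d n r (tt_entry 0 d r G 0)"
    unfolding has_tt_ranks_def tt_entry_def using r0 rd r_pos G
    by (intro conjI exI[of _ G]) (auto simp: Suc_le_eq simp del: upt_Suc)
  moreover have "\<forall>k\<in>{1..d - 1}. let N = min (n k * r (k - 1)) (\<Prod>s = k + 1..d. n s) in
      int (r k) \<le> \<lceil>log ((\<tau> k)\<^sup>2)
        ((1 - (\<tau> k)\<^sup>2) * \<epsilon>\<^sup>2 / (real d - 1) + (\<tau> k) ^ (2 * N))\<rceil>"
    using r_trunc(3) r_pos by (simp add: bound_def N_def)
  ultimately show ?thesis
    by blast
qed

end
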